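(* Let $\omega_0$ and $\omega_1$ carry the discrete topology, let $\beta\omega_0$ and $\beta\omega_1$ be their Čech–Stone compactifications, and put $\omega_0^*=\beta\omega_0\setminus\omega_0$ and $\omega_1^*=\beta\omega_1\setminus\omega_1$. Let $\mathbb{V}$ be the subspace $(\beta\omega_1\times\beta\omega_0)\setminus(\omega_1^*\times\omega_0^* )$ of the product space $\beta\omega_1\times\beta\omega_0$, and let $R=\omega_1^*\times\omega_0\subseteq\mathbb{V}$. Then $\mathbb{V}$ is realcompact, and $R$ is a closed subset of $\mathbb{V}$ that is $C^*$-embedded in $\mathbb{V}$ but not $C$-embedded in $\mathbb{V}$.
   Context: A space is realcompact if it can be embedded as a closed subset into a power $\mathbb{R}^\kappa$ of the real line (with the product topology). A subset $A$ of a space $X$ is $C$-embedded in $X$ if every continuous function $f:A\to\mathbb{R}$ admits a continuous extension $\bar f:X\to\mathbb{R}$; it is $C^*$-embedded in $X$ if every bounded continuous function $f:A\to\mathbb{R}$ admits a bounded continuous extension $\bar f:X\to\mathbb{R}$. Here $\omega_0$ is the first infinite ordinal and $\omega_1$ the first uncountable ordinal, both regarded as discrete spaces and as subsets of their Čech–Stone compactifications. *)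

theory Defs
  imports "HOL-Analysis.Analysis"
begin

section \<open>Realcompactness and extension of functions\<close>

text \<open>
  The exponent of the power of the real line is an index set of real functions on the carrier.
  This is no restriction: coordinates of an embedding that agree as functions on \<open>X\<close> can be
  merged, see \<open>realcompact_spaceI\<close>, which accepts an arbitrary index type.
\<close>

definition realcompact_space :: "'a topology \<Rightarrow> bool" where
  "realcompact_space X \<longleftrightarrow>
     (\<exists>(K :: ('a \<Rightarrow> real) set) e.
        embedding_map X (product_topology (\<lambda>_. euclideanreal) K) e \<and>
        closedin (product_topology (\<lambda>_. euclideanreal) K) (e ` topspace X))"

definition C_embedded :: "'a topology \<Rightarrow> 'a set \<Rightarrow> bool" where
  "C_embedded X A \<longleftrightarrow> A \<subseteq> topspace X \<and>
     (\<forall>f. continuous_map (subtopology X A) euclideanreal f \<longrightarrow>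
        (\<exists>g. continuous_map X euclideanreal g \<and> (\<forall>x\<in>A. g x = f x)))"

definition C_star_embedded :: "'a topology \<Rightarrow> 'a set \<Rightarrow> bool" where
  "C_star_embedded X A \<longleftrightarrow> A \<subseteq> topspace X \<and>
     (\<forall>f. continuous_map (subtopology X A) euclideanreal f \<and> bounded (f ` A) \<longrightarrow>
        (\<exists>g. continuous_map X euclideanreal g \<and> bounded (g ` topspace X) \<and> (\<forall>x\<in>A. g x = f x)))"

lemma realcompact_spaceI:
  fixes K :: "'i set" and e :: "'a \<Rightarrow> 'i \<Rightarrow> real"
  assumes emb: "embedding_map X (product_topology (\<lambda>_. euclideanreal) K) e"
    and clo: "closedin (product_topology (\<lambda>_. euclideanreal) K) (e ` topspace X)"
  shows "realcompact_space X"
proof -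
  define P where "P = product_topology (\<lambda>_::'i. euclideanreal) K"
  define c where "c i = (\<lambda>x. e x i)" for i
  define K' where "K' = c ` K"
  define P' where "P' = product_topology (\<lambda>_::'a \<Rightarrow> real. euclideanreal) K'"
  define e' where "e' x = (\<lambda>f\<in>K'. f x)" for x
  define T where "T g = (\<lambda>i\<in>K. g (c i) :: real)" for g
  have hom: "homeomorphic_map X (subtopology P (e ` topspace X)) e"
    using emb by (simp add: embedding_map_def P_def)
  then have conte: "continuous_map X P e"
    by (meson continuous_map_in_subtopology homeomorphic_imp_continuous_map)
  have exten: "e x \<in> extensional K" if "x \<in> topspace X" for x
    using conte that unfolding P_def
    by (auto simp: continuous_map_def topspace_product_topology PiE_def)
  have conte': "continuous_map X P' e'"
    using conte unfolding P_def P'_def K'_def e'_def c_def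
    by (auto simp: continuous_map_componentwise)
  have contT: "continuous_map P' P T"
    unfolding P_def P'_def T_def K'_def
    by (auto simp: continuous_map_componentwise intro!: continuous_map_product_projection)
  have Te': "T (e' x) = e x" if "x \<in> topspace X" for x
    using exten[OF that] by (auto simp: T_def e'_def K'_def c_def extensional_def fun_eq_iff)
  obtain h where h: "continuous_map (subtopology P (e ` topspace X)) X h"
      and he: "\<And>x. x \<in> topspace X \<Longrightarrow> h (e x) = x"
    using hom unfolding homeomorphic_map_maps homeomorphic_maps_def by blast
  have "continuous_map (subtopology P' (e' ` topspace X)) (subtopology P (e ` topspace X)) T"
    using contT Te' by (auto simp: continuous_map_in_subtopology continuous_map_from_subtopology)
  then have hT: "continuous_map (subtopology P' (e' ` topspace X)) X (h \<circ> T)"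
    using h continuous_map_compose by blast
  have "homeomorphic_maps X (subtopology P' (e' ` topspace X)) e' (h \<circ> T)"
    unfolding homeomorphic_maps_def
    using conte' hT Te' he by (auto simp: continuous_map_in_subtopology)
  then have emb': "embedding_map X P' e'"
    unfolding embedding_map_def homeomorphic_map_maps by blast
  have "e' ` topspace X = {g \<in> topspace P'. T g \<in> e ` topspace X}"
  proof (intro equalityI subsetI)
    fix g assume "g \<in> e' ` topspace X"
    then show "g \<in> {g \<in> topspace P'. T g \<in> e ` topspace X}"
      using Te' conte' by (auto simp: continuous_map_def)
  next
    fix g assume "g \<in> {g \<in> topspace P'. T g \<in> e ` topspace X}"
    then obtain x where x: "x \<in> topspace X" "T g = e x" and g: "g \<in> topspace P'"
      by auto
    have "g (c i) = c i x" if "i \<in> K" for i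
      using fun_cong[OF x(2), of i] that by (simp add: T_def c_def)
    then have "g = e' x"
      using g by (auto simp: P'_def e'_def K'_def PiE_def extensional_def fun_eq_iff)
    then show "g \<in> e' ` topspace X" using x by blast
  qed
  moreover have "closedin P' {g \<in> topspace P'. T g \<in> e ` topspace X}"
    using clo contT closedin_continuous_map_preimage unfolding P_def by blast
  ultimately show ?thesis
    using emb' unfolding realcompact_space_def P'_def by metis
qed


section \<open>The Cech--Stone compactification\<close>

text \<open>
  The standard construction: the closure of the image of \<open>X\<close> under the evaluation map in the
  cube indexed by all continuous functions from \<open>X\<close> to the unit interval. Elements of \<open>X\<close> are
  identified with their images under \<open>beta_emb X\<close>.
\<close>

definition unit_functions :: "'a topology \<Rightarrow> ('a \<Rightarrow> real) set" where
  "unit_functions X =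
     {f \<in> extensional (topspace X). continuous_map X (top_of_set {0..1}) f}"

definition beta_emb :: "'a topology \<Rightarrow> 'a \<Rightarrow> ('a \<Rightarrow> real) \<Rightarrow> real" where
  "beta_emb X x = (\<lambda>f\<in>unit_functions X. f x)"

definition beta :: "'a topology \<Rightarrow> (('a \<Rightarrow> real) \<Rightarrow> real) topology" where
  "beta X =
     (let Q = product_topology (\<lambda>_. top_of_set {0..1}) (unit_functions X)
      in subtopology Q (Q closure_of (beta_emb X ` topspace X)))"

definition beta_remainder :: "'a topology \<Rightarrow> (('a \<Rightarrow> real) \<Rightarrow> real) set" where
  "beta_remainder X = topspace (beta X) - beta_emb X ` topspace X"

lemma compact_space_beta: "compact_space (beta X)"
  by (simp add: beta_def Let_def closedin_compact_space compact_space_product_topology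
      compact_space_subtopology)

lemma Hausdorff_space_beta: "Hausdorff_space (beta X)"
  by (simp add: beta_def Let_def Hausdorff_space_subtopology Hausdorff_space_product_topology)


section \<open>The space \<open>\<V>\<close>\<close>

definition omega0 :: "nat topology" where
  "omega0 = discrete_topology (Field natLeq)"

text \<open>
  The cardinal successor of \<open>natLeq\<close> is a well-order of type \<open>\<omega>\<^sub>1\<close>, so its field serves as the
  set of countable ordinals.
\<close>

definition omega1 :: "nat set topology" where
  "omega1 = discrete_topology (Field (cardSuc natLeq))"

type_synonym V_point = "((nat set \<Rightarrow> real) \<Rightarrow> real) \<times> ((nat \<Rightarrow> real) \<Rightarrow> real)"

definition V_space :: "V_point topology" where
  "V_space =
     subtopology (prod_topology (beta omega1) (beta omega0))
       (topspace (beta omega1) \<times> topspace (beta omega0) -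
        beta_remainder omega1 \<times> beta_remainder omega0)"

definition R_set :: "V_point set" where
  "R_set = beta_remainder omega1 \<times> beta_emb omega0 ` topspace omega0"

end

theory Submission
  imports Defs "HOL-Library.Countable_Set_Type"
begin

text \<open>
  The space \<open>\<V>\<close> is the union of the columns \<open>\<beta>\<omega>\<^sub>1 \<times> {n}\<close> and the rows \<open>{s} \<times> \<beta>\<omega>\<^sub>0\<close>, where \<open>n\<close>
  and \<open>s\<close> range over the two discrete spaces. Points of a discrete space are isolated in its
  compactification, so all columns and rows are compact and open in \<open>\<V>\<close>, and a function on \<open>\<V>\<close> is
  continuous as soon as its restrictions to columns and rows are. The set \<open>R\<close> is the union of the
  remainders of the columns.

  Realcompactness. A subspace \<open>V\<close> of a compact Hausdorff space \<open>W\<close> is realcompact if every point of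
  \<open>W - V\<close> is a zero of a continuous function on \<open>W\<close> without zeros on \<open>V\<close>
  (\<open>realcompact_space_subtopology_compact\<close>): the reciprocal of such a function blows up at that point.
  For \<open>\<V>\<close> inside \<open>\<beta>\<omega>\<^sub>1 \<times> \<beta>\<omega>\<^sub>0\<close> the points to be excluded are pairs \<open>(u, v)\<close> of points of the two
  remainders. If \<open>H\<close> and \<open>G\<close> vanish at \<open>u\<close> and at \<open>v\<close> but at no isolated point, then
  \<open>\<bar>H x\<bar> + \<bar>G y\<bar>\<close> vanishes at \<open>(u, v)\<close> but nowhere on \<open>\<V>\<close>. That such an \<open>H\<close> exists
  (\<open>beta_remainder_vanishing_function\<close>) says that \<open>\<omega>\<^sub>1\<close> itself is realcompact; this follows from
  \<open>\<omega>\<^sub>1\<close> having at most the cardinality of the continuum.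

  Extending bounded functions. Given a function on \<open>R\<close> with values in \<open>[-B, B]\<close>, Tietze's theorem extends
  it over each column with values in \<open>[-B, B]\<close>. On a row it is now defined at the isolated points, where
  it is bounded by \<open>B\<close>, so it extends over the whole row by the universal property of \<open>\<beta>\<omega>\<^sub>0\<close>.

  An unbounded function that does not extend. The function with value \<open>n\<close> on the part of \<open>R\<close> in the
  column \<open>n\<close> is continuous. If \<open>g\<close> is an extension to \<open>\<V>\<close>, then in column \<open>n\<close> the closed set where
  \<open>g\<close> differs from \<open>n\<close> by at least \<open>1\<close> misses the remainder, hence is finite
  (\<open>finite_closedin_beta\<close>). As \<open>\<omega>\<^sub>1\<close> is uncountable, some row avoids all these exceptional
  sets. On that row \<open>g\<close> is unbounded, although the row is compact.
\<close>


section \<open>Recognising realcompact spaces\<close>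

text \<open>
  The subspace \<open>V\<close> is mapped into the power of the real line indexed by all its continuous real
  functions, by evaluation. A point \<open>z\<close> in the closure of the image of a closed set \<open>C\<close> is approximated by
  points of \<open>C\<close>, which by compactness of \<open>W\<close> accumulate at some \<open>p\<close>. If \<open>p\<close> were outside \<open>V\<close>, then
  the reciprocal of a function vanishing at \<open>p\<close> would be close to a finite coordinate of \<open>z\<close> on points
  arbitrarily close to \<open>p\<close>. So \<open>p\<close> lies in \<open>V\<close>, hence in \<open>C\<close>, and \<open>z\<close> is its image.
  The evaluation is therefore a closed map, which shows at once that it is an embedding and that its
  range is closed.
\<close>

lemma realcompact_space_subtopology_compact:
  assumes W: "compact_space W" "Hausdorff_space W" and V: "V \<subseteq> topspace W"
    and sep: "\<And>p. p \<in> topspace W - V \<Longrightarrow>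
      \<exists>f. continuous_map W euclideanreal f \<and> f p = 0 \<and> (\<forall>x\<in>V. f x \<noteq> 0)"
  shows "realcompact_space (subtopology W V)"
proof -
  define X where "X = subtopology W V"
  define K where "K = {f. continuous_map X euclideanreal f}"
  define P where "P = product_topology (\<lambda>_::'a \<Rightarrow> real. euclideanreal) K"
  define e where "e x = (\<lambda>f\<in>K. f x)" for x
  have topX: "topspace X = V"
    using V by (auto simp: X_def)
  have ext: "f \<in> K" if "continuous_map W euclideanreal f" for f
    using that by (simp add: K_def X_def continuous_map_from_subtopology)
  have conte: "continuous_map X P e"
    unfolding P_def e_def by (auto simp: continuous_map_componentwise K_def)
  have proj: "continuous_map P euclideanreal (\<lambda>w. w f)" if "f \<in> K" for f
    using that unfolding P_def by (rule continuous_map_product_projection)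
  have "inj_on e V"
  proof (rule inj_onI, rule ccontr)
    fix x y assume xy: "x \<in> V" "y \<in> V" "e x = e y" "x \<noteq> y"
    have "normal_space W"
      using W compact_Hausdorff_or_regular_imp_normal_space by blast
    moreover have "closedin W {x}" "closedin W {y}"
      using W xy V by (auto simp: closedin_Hausdorff_singleton)
    moreover have "disjnt {x} {y}"
      using xy by auto
    ultimately obtain f where f: "continuous_map W (top_of_set {0..1::real}) f"
        "f ` {x} \<subseteq> {0}" "f ` {y} \<subseteq> {1}"
      using Urysohn_lemma[of W "{x}" "{y}" 0 1] by (metis zero_le_one)
    have "f \<in> K"
      using f ext by (simp add: continuous_map_in_subtopology)
    then have "f x = f y"
      using fun_cong[OF xy(3), of f] by (simp add: e_def)
    then show False
      using f by auto
  qed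
  have clo: "closedin P (e ` C)" if C: "closedin X C" for C
  proof -
    have CV: "C \<subseteq> V"
      using C closedin_subset topX by blast
    have eC: "e ` C \<subseteq> topspace P"
      using CV conte topX by (auto simp: continuous_map_def)
    have "z \<in> e ` C" if z: "z \<in> P closure_of (e ` C)" for z
    proof -
      \<comment> \<open>The preimages in \<open>C\<close> of the neighbourhoods of \<open>z\<close> form a filter base; \<open>p\<close> is a cluster point of it.\<close>
      define S where "S N = {x \<in> C. e x \<in> N}" for N
      define \<U> where "\<U> = {W closure_of (S N) |N. openin P N \<and> z \<in> N}"
      have zP: "z \<in> topspace P"
        using z by (simp add: in_closure_of)
      have "\<Inter>\<F> \<noteq> {}" if \<F>: "finite \<F>" "\<F> \<subseteq> \<U>" for \<F>
      proof -
        have "\<forall>A\<in>\<F>. \<exists>N. A = W closure_of (S N) \<and> openin P N \<and> z \<in> N"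
          using \<F> by (auto simp: \<U>_def)
        then obtain n where n: "\<And>A. A \<in> \<F> \<Longrightarrow> A = W closure_of (S (n A))"
            "\<And>A. A \<in> \<F> \<Longrightarrow> openin P (n A)" "\<And>A. A \<in> \<F> \<Longrightarrow> z \<in> n A"
          by metis
        have "openin P (topspace P \<inter> \<Inter>(n ` \<F>))"
          using \<F>(1) n(2) by (cases "\<F> = {}") (auto intro!: openin_Int openin_Inter)
        moreover have "z \<in> topspace P \<inter> \<Inter>(n ` \<F>)"
          using zP n(3) by blast
        ultimately have "\<exists>w. w \<in> e ` C \<and> w \<in> topspace P \<inter> \<Inter>(n ` \<F>)"
          using z unfolding in_closure_of by blast
        then obtain x where x: "x \<in> C" "\<forall>A\<in>\<F>. e x \<in> n A"
          by blast
        have "x \<in> A" if "A \<in> \<F>" for A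
        proof -
          have "S (n A) \<subseteq> topspace W"
            using CV V by (auto simp: S_def)
          then show ?thesis
            using n(1)[OF that] x that closure_of_subset[of "S (n A)" W] by (auto simp: S_def)
        qed
        then show ?thesis by blast
      qed
      then have "\<forall>\<F>. finite \<F> \<and> \<F> \<subseteq> \<U> \<longrightarrow> \<Inter>\<F> \<noteq> {}"
        by simp
      moreover have "\<forall>A\<in>\<U>. closedin W A"
        by (auto simp: \<U>_def)
      ultimately have "\<Inter>\<U> \<noteq> {}"
        using W(1)[unfolded compact_space_fip, THEN spec, of \<U>] by simp
      then obtain p where p: "\<And>N. openin P N \<Longrightarrow> z \<in> N \<Longrightarrow> p \<in> W closure_of (S N)"
        by (auto simp: \<U>_def)
      have near: "p \<in> W closure_of {x \<in> C. \<bar>f x - z f\<bar> < d}" if "f \<in> K" "d > 0" for f d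
      proof -
        let ?N = "{w \<in> topspace P. w f \<in> ball (z f) d}"
        have "openin P ?N"
          using openin_continuous_map_preimage[OF proj[OF that(1)], of "ball (z f) d"] by simp
        then have "p \<in> W closure_of (S ?N)"
          using p zP that by auto
        moreover have "S ?N \<subseteq> {x \<in> C. \<bar>f x - z f\<bar> < d}"
          using that by (auto simp: S_def e_def dist_real_def)
        ultimately show ?thesis
          using closure_of_mono by blast
      qed
      have "p \<in> W closure_of (S (topspace P))"
        using p zP by simp
      moreover have "S (topspace P) \<subseteq> C"
        by (auto simp: S_def)
      ultimately have pC: "p \<in> W closure_of C"
        using closure_of_mono by blast
      then have pW: "p \<in> topspace W"
        by (simp add: in_closure_of)
      have pV: "p \<in> V"
      proof (rule ccontr)
        assume "p \<notin> V"
        then obtain f where f: "continuous_map W euclideanreal f" "f p = 0" "\<And>x. x \<in> V \<Longrightarrow> f x \<noteq> 0"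
          using sep pW by blast
        let ?g = "\<lambda>x. inverse (f x)"
        have "?g \<in> K"
          using f topX unfolding K_def
          by (auto intro!: continuous_map_real_inverse simp: X_def continuous_map_from_subtopology)
        then have "p \<in> W closure_of {x \<in> C. \<bar>?g x - z ?g\<bar> < 1}"
          by (rule near) simp
        then have "\<bar>f p\<bar> \<ge> inverse (\<bar>z ?g\<bar> + 1)"
        proof (rule forall_in_closure_of)
          fix x assume x: "x \<in> {x \<in> C. \<bar>?g x - z ?g\<bar> < 1}"
          then have nz: "f x \<noteq> 0"
            using CV f(3) by auto
          have "inverse \<bar>f x\<bar> \<le> \<bar>z ?g\<bar> + 1"
            using x by (auto simp flip: abs_inverse)
          then have "inverse (\<bar>z ?g\<bar> + 1) \<le> inverse (inverse \<bar>f x\<bar>)"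
            using nz by (intro le_imp_inverse_le) auto
          then show "\<bar>f x\<bar> \<ge> inverse (\<bar>z ?g\<bar> + 1)"
            using nz by simp
        next
          have "continuous_map W euclideanreal (\<lambda>x. \<bar>f x\<bar>)"
            using f(1) by (rule continuous_map_real_abs)
          from closedin_continuous_map_preimage[OF this, of "{inverse (\<bar>z ?g\<bar> + 1)..}"]
          show "closedin W {x \<in> topspace W. \<bar>f x\<bar> \<ge> inverse (\<bar>z ?g\<bar> + 1)}"
            by simp
        qed
        moreover have "inverse (\<bar>z ?g\<bar> + 1) > 0"
          by simp
        ultimately show False
          using f(2) by simp
      qed
      have inX: "p \<in> X closure_of A" if "p \<in> W closure_of A" "A \<subseteq> V" for A
        using that pV by (simp add: X_def closure_of_subtopology Int_absorb1)
      have "p \<in> C"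
        using inX[OF pC CV] C by (simp add: closure_of_closedin)
      moreover have "z = e p"
      proof
        fix f show "z f = e p f"
        proof (cases "f \<in> K")
          case True
          then have contf: "continuous_map X euclideanreal f"
            by (simp add: K_def)
          have "\<bar>f p - z f\<bar> \<le> d" if "d > 0" for d
          proof (rule forall_in_closure_of[where P = "\<lambda>x. \<bar>f x - z f\<bar> \<le> d" and X = X
                and S = "{x \<in> C. \<bar>f x - z f\<bar> < d}"])
            show "p \<in> X closure_of {x \<in> C. \<bar>f x - z f\<bar> < d}"
              using near[OF True that] CV by (intro inX) auto
            have "continuous_map X euclideanreal (\<lambda>x. \<bar>f x - z f\<bar>)"
              using contf by (intro continuous_intros) auto
            from closedin_continuous_map_preimage[OF this, of "{..d}"]
            show "closedin X {x \<in> topspace X. \<bar>f x - z f\<bar> \<le> d}"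
              by simp
          qed auto
          then have "\<bar>f p - z f\<bar> \<le> 0 + d" if "d > 0" for d
            using that by simp
          then have "\<bar>f p - z f\<bar> \<le> 0"
            by (rule field_le_epsilon)
          then show ?thesis
            using True by (simp add: e_def)
        next
          case False
          then show ?thesis
            using zP by (auto simp: P_def e_def PiE_def extensional_def)
        qed
      qed
      ultimately show ?thesis by blast
    qed
    then show ?thesis
      using eC closure_of_subset_eq[of "e ` C" P] by blast
  qed
  have "embedding_map X P e"
    using conte clo \<open>inj_on e V\<close> topX
    by (intro injective_closed_imp_embedding_map) (auto simp: closed_map_def)
  moreover have "closedin P (e ` topspace X)"
    using clo by blast
  ultimately show ?thesis
    unfolding X_def[symmetric] P_def by (rule realcompact_spaceI)
qed


section \<open>The Cech--Stone compactification of a discrete space\<close>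

lemma beta_emb_subset_cube:
  "beta_emb X ` topspace X
    \<subseteq> topspace (product_topology (\<lambda>_. top_of_set {0..1}) (unit_functions X))"
proof -
  have "f x \<in> {0..1}" if "f \<in> unit_functions X" "x \<in> topspace X" for f x
    using that continuous_map_image_subset_topspace[of X "top_of_set {0..1}" f]
    by (auto simp: unit_functions_def image_subset_iff)
  then show ?thesis
    by (auto simp: beta_emb_def)
qed

lemma beta_emb_in_topspace:
  assumes "x \<in> topspace X"
  shows "beta_emb X x \<in> topspace (beta X)"
  using assms beta_emb_subset_cube[of X] closure_of_subset[OF beta_emb_subset_cube, of X]
  unfolding beta_def Let_def topspace_subtopology by blast

lemma beta_closure_of_emb: "beta X closure_of (beta_emb X ` topspace X) = topspace (beta X)"
proof -
  define Q where "Q = product_topology (\<lambda>_. top_of_set {0..1::real}) (unit_functions X)"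
  have "beta_emb X ` topspace X \<subseteq> topspace Q"
    unfolding Q_def by (rule beta_emb_subset_cube)
  then have "beta_emb X ` topspace X \<subseteq> Q closure_of (beta_emb X ` topspace X)"
    by (rule closure_of_subset)
  moreover have "beta X = subtopology Q (Q closure_of (beta_emb X ` topspace X))"
    by (simp add: beta_def Q_def Let_def)
  ultimately show ?thesis
    by (simp add: closure_of_subtopology Int_absorb1 closure_of_subset_topspace)
qed

text \<open>
  A function with values in \<open>[-B, B]\<close>, rescaled to the unit interval, is one of the coordinates of the
  cube that contains the compactification; the extension is this coordinate, rescaled back.
\<close>

lemma beta_extension:
  fixes h :: "'a \<Rightarrow> real"
  assumes h: "continuous_map X euclideanreal h" and bnd: "\<And>x. x \<in> topspace X \<Longrightarrow> \<bar>h x\<bar> \<le> B"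
    and B: "0 < B"
  obtains H where "continuous_map (beta X) euclideanreal H"
    "\<And>x. x \<in> topspace X \<Longrightarrow> H (beta_emb X x) = h x"
    "\<And>y. y \<in> topspace (beta X) \<Longrightarrow> \<bar>H y\<bar> \<le> B"
proof -
  define f where "f = restrict (\<lambda>x. (h x + B) / (2 * B)) (topspace X)"
  have "continuous_map X euclideanreal (\<lambda>x. (h x + B) / (2 * B))"
    using h B by (intro continuous_intros) auto
  then have "continuous_map X euclideanreal f"
    by (rule continuous_map_eq) (simp add: f_def)
  moreover have "f x \<in> {0..1}" if "x \<in> topspace X" for x
    using bnd[OF that] B that by (auto simp: f_def divide_simps)
  ultimately have f: "f \<in> unit_functions X"
    by (auto simp: unit_functions_def continuous_map_in_subtopology f_def)
  have "continuous_map (beta X) (top_of_set {0..1}) (\<lambda>y. y f)"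
    using f unfolding beta_def Let_def
    by (intro continuous_map_from_subtopology continuous_map_product_projection)
  then have cont: "continuous_map (beta X) euclideanreal (\<lambda>y. y f)"
      and range: "\<And>y. y \<in> topspace (beta X) \<Longrightarrow> y f \<in> {0..1}"
    by (auto simp: continuous_map_in_subtopology)
  show thesis
  proof
    show "continuous_map (beta X) euclideanreal (\<lambda>y. 2 * B * y f - B)"
      using cont by (intro continuous_intros) auto
    show "2 * B * beta_emb X x f - B = h x" if "x \<in> topspace X" for x
      using f B that by (simp add: beta_emb_def) (simp add: f_def)
    show "\<bar>2 * B * y f - B\<bar> \<le> B" if "y \<in> topspace (beta X)" for y
      using range[OF that] B by (auto simp: abs_le_iff)
  qed
qed

lemma beta_discrete_extension:
  fixes h :: "'a \<Rightarrow> real"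
  assumes bnd: "\<forall>s\<in>D. \<bar>h s\<bar> \<le> B" and B: "0 < B"
  shows "\<exists>H. continuous_map (beta (discrete_topology D)) euclideanreal H \<and>
    (\<forall>s\<in>D. H (beta_emb (discrete_topology D) s) = h s) \<and>
    (\<forall>y\<in>topspace (beta (discrete_topology D)). \<bar>H y\<bar> \<le> B)"
proof -
  have "continuous_map (discrete_topology D) euclideanreal h"
    by simp
  from beta_extension[OF this _ B] bnd show ?thesis
    by (metis topspace_discrete_topology)
qed

lemma inj_on_beta_emb: "inj_on (beta_emb (discrete_topology D)) D"
proof (rule inj_onI)
  let ?X = "discrete_topology D"
  fix s t assume st: "s \<in> D" "t \<in> D" "beta_emb ?X s = beta_emb ?X t"
  have "\<forall>t\<in>D. \<bar>of_bool (t = s) :: real\<bar> \<le> 1"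
    by simp
  from beta_discrete_extension[of D "\<lambda>t. of_bool (t = s)" 1, OF this zero_less_one]
  obtain H where H: "\<forall>t\<in>D. H (beta_emb ?X t) = (of_bool (t = s) :: real)"
    by blast
  have "(of_bool (t = s) :: real) = of_bool (s = s)"
    using H st by metis
  then show "s = t"
    by (simp split: if_splits)
qed

text \<open>
  The extension of the indicator function of \<open>s\<close> is positive on a neighbourhood of \<open>s\<close> that contains no
  other point of the dense set \<open>D\<close>; an open set meeting a dense set in one point of a Hausdorff space
  is a singleton.
\<close>

lemma openin_beta_singleton:
  assumes s: "s \<in> D"
  shows "openin (beta (discrete_topology D)) {beta_emb (discrete_topology D) s}"
proof -
  let ?X = "discrete_topology D"
  have "\<forall>t\<in>D. \<bar>of_bool (t = s) :: real\<bar> \<le> 1"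
    by simp
  from beta_discrete_extension[of D "\<lambda>t. of_bool (t = s)" 1, OF this zero_less_one]
  obtain H where H: "continuous_map (beta ?X) euclideanreal H"
      "\<forall>t\<in>D. H (beta_emb ?X t) = of_bool (t = s)"
    by (elim exE conjE)
  let ?U = "{y \<in> topspace (beta ?X). H y \<in> {0<..}}"
  have U: "openin (beta ?X) ?U"
    using openin_continuous_map_preimage[OF H(1), of "{0<..}"] by simp
  have sT: "beta_emb ?X s \<in> topspace (beta ?X)"
    using s by (intro beta_emb_in_topspace) simp
  have "?U = {beta_emb ?X s}"
  proof (rule ccontr)
    assume "?U \<noteq> {beta_emb ?X s}"
    moreover have "beta_emb ?X s \<in> ?U"
      using H s sT by simp
    ultimately obtain y where y: "y \<in> ?U" "y \<noteq> beta_emb ?X s"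
      by blast
    have "closedin (beta ?X) {beta_emb ?X s}"
      using Hausdorff_space_beta sT by (rule closedin_Hausdorff_singleton)
    then have "openin (beta ?X) (?U - {beta_emb ?X s})"
      using U by blast
    moreover have "y \<in> beta ?X closure_of (beta_emb ?X ` D)"
      using beta_closure_of_emb[of ?X] y by simp
    moreover have "y \<in> ?U - {beta_emb ?X s}"
      using y by simp
    ultimately obtain w where "w \<in> beta_emb ?X ` D" "w \<in> ?U - {beta_emb ?X s}"
      unfolding in_closure_of by meson
    then show False
      using H(2) by (auto split: if_splits)
  qed
  then show ?thesis
    using U by simp
qed

lemma closedin_beta_remainder:
  "closedin (beta (discrete_topology D)) (beta_remainder (discrete_topology D))"
proof -
  let ?X = "discrete_topology D"
  have "openin (beta ?X) (\<Union>s\<in>D. {beta_emb ?X s})"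
    using openin_beta_singleton by (intro openin_Union) auto
  then show ?thesis
    unfolding beta_remainder_def by (auto simp: closedin_diff UNION_singleton_eq_range)
qed

text \<open>Such a set is compact and consists of isolated points.\<close>

lemma finite_closedin_beta:
  assumes T: "closedin (beta (discrete_topology D)) T"
    and disj: "T \<inter> beta_remainder (discrete_topology D) = {}"
  shows "finite T"
proof -
  let ?X = "discrete_topology D"
  have T': "T \<subseteq> beta_emb ?X ` D"
    using disj closedin_subset[OF T] by (auto simp: beta_remainder_def)
  have "compactin (beta ?X) T"
    using T compact_space_beta closedin_compact_space by blast
  moreover have "openin (beta ?X) U" if "U \<in> (\<lambda>y. {y}) ` T" for U
    using that openin_beta_singleton[of _ D] T' by auto
  moreover have "T \<subseteq> \<Union>((\<lambda>y. {y}) ` T)"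
    by auto
  ultimately have "\<exists>\<F>. finite \<F> \<and> \<F> \<subseteq> (\<lambda>y. {y}) ` T \<and> T \<subseteq> \<Union>\<F>"
    by (rule compactinD)
  then obtain \<F> where \<F>: "finite \<F>" "\<F> \<subseteq> (\<lambda>y. {y}) ` T" "T \<subseteq> \<Union>\<F>"
    by (elim exE conjE)
  then have "finite (\<Union>\<F>)"
    by (auto intro!: finite_Union)
  then show ?thesis
    using \<F> finite_subset by blast
qed

text \<open>
  Let \<open>C\<close> extend the injection \<open>c\<close>. The function \<open>\<bar>C - C u\<bar>\<close> vanishes at \<open>u\<close>, and by injectivity
  it has at most one zero in \<open>D\<close>. Changing its value at that isolated point affects nothing near \<open>u\<close>.
  In terms of ultrafilters: an ultrafilter on a set of reals that is closed under countable
  intersections is principal.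
\<close>

lemma beta_remainder_vanishing_function:
  fixes c :: "'a \<Rightarrow> real"
  assumes c: "inj_on c D" "c ` D \<subseteq> {0..1}" and u: "u \<in> beta_remainder (discrete_topology D)"
  obtains H where "continuous_map (beta (discrete_topology D)) euclideanreal H" "H u = 0"
    "\<And>s. s \<in> D \<Longrightarrow> H (beta_emb (discrete_topology D) s) \<noteq> 0"
proof -
  let ?X = "discrete_topology D"
  have uT: "u \<in> topspace (beta ?X)"
    using u by (simp add: beta_remainder_def)
  have c1: "\<forall>s\<in>D. \<bar>c s\<bar> \<le> 1"
    using c(2) by fastforce
  from beta_discrete_extension[of D c 1, OF c1 zero_less_one]
  obtain C where C: "continuous_map (beta ?X) euclideanreal C"
      "\<forall>s\<in>D. C (beta_emb ?X s) = c s" "\<forall>y\<in>topspace (beta ?X). \<bar>C y\<bar> \<le> 1"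
    by (elim exE conjE)
  define h where "h s = (if c s = C u then 1 else \<bar>c s - C u\<bar>)" for s
  have "\<bar>h s\<bar> \<le> 2" if "s \<in> D" for s
    using bspec[OF C(3) uT] bspec[OF c1 that] by (auto simp: h_def)
  then have h2: "\<forall>s\<in>D. \<bar>h s\<bar> \<le> 2" ..
  from beta_discrete_extension[of D h 2, OF h2 zero_less_numeral]
  obtain H where H: "continuous_map (beta ?X) euclideanreal H"
      "\<forall>s\<in>D. H (beta_emb ?X s) = h s"
    by (elim exE conjE)
  define F where "F = beta_emb ?X ` (c -` {C u} \<inter> D)"
  have "finite F"
    unfolding F_def using c(1) by (intro finite_imageI finite_vimage_IntI) auto
  then have "closedin (beta ?X) F"
    using Hausdorff_space_beta beta_emb_in_topspace[of _ ?X]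
    by (intro closedin_Hausdorff_finite) (auto simp: F_def)
  then have "openin (beta ?X) (topspace (beta ?X) - F)"
    by blast
  moreover have "u \<in> topspace (beta ?X) - F"
    using u by (auto simp: beta_remainder_def F_def)
  moreover have "u \<in> beta ?X closure_of (beta_emb ?X ` D)"
    using beta_closure_of_emb[of ?X] uT by simp
  ultimately have "u \<in> beta ?X closure_of ((topspace (beta ?X) - F) \<inter> beta_emb ?X ` D)"
    using openin_Int_closure_of_subset by blast
  then have "u \<in> beta ?X closure_of (beta_emb ?X ` D - F)"
    by (rule rev_subsetD) (intro closure_of_mono, blast)
  then have "H u = \<bar>C u - C u\<bar>"
  proof (rule forall_in_closure_of_eq[where Y = euclideanreal and f = H
        and g = "\<lambda>y. \<bar>C y - C u\<bar>"])
    show "continuous_map (beta ?X) euclideanreal (\<lambda>y. \<bar>C y - C u\<bar>)"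
      using C(1) by (intro continuous_intros) auto
    show "H y = \<bar>C y - C u\<bar>" if "y \<in> beta_emb ?X ` D - F" for y
      using that H(2) C(2) by (auto simp: F_def h_def)
  qed (use H in auto)
  then show thesis
    using that[OF H(1)] H(2) by (simp add: h_def)
qed


section \<open>Realcompactness of \<open>\<V>\<close>\<close>

lemma topspace_omega0: "topspace omega0 = UNIV"
  by (simp add: omega0_def Field_natLeq)

lemma uncountable_topspace_omega1:
  includes cardinal_syntax
  shows "uncountable (topspace omega1)"
proof
  let ?r = "cardSuc natLeq"
  assume "countable (topspace omega1)"
  then have "|Field ?r| \<le>o natLeq"
    by (simp add: omega1_def countable_card_le_natLeq)
  moreover have "(card_of (Field ?r), ?r) \<in> ordIso"
    using natLeq_Card_order cardSuc_Card_order card_of_Field_ordIso by blast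
  ultimately have "?r \<le>o natLeq"
    using ordIso_ordLeq_trans ordIso_symmetric by blast
  then show False
    using cardSuc_greater[OF natLeq_Card_order] not_ordLess_ordLeq by blast
qed

lemma topspace_V: "topspace V_space =
    topspace (beta omega1) \<times> topspace (beta omega0) - beta_remainder omega1 \<times> beta_remainder omega0"
  by (auto simp: V_space_def)

lemma realcompact_V: "realcompact_space V_space"
proof -
  let ?W = "prod_topology (beta omega1) (beta omega0)"
  obtain c1 :: "nat set \<Rightarrow> real" where c1: "inj_on c1 UNIV" "c1 ` UNIV \<subseteq> {0..<1}"
    using nat_sets_lepoll_reals01 unfolding lepoll_def by blast
  define c0 where "c0 n = c1 {n}" for n
  have c1': "inj_on c1 (topspace omega1)" "c1 ` topspace omega1 \<subseteq> {0..1}"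
    using c1 by (auto simp: inj_on_def less_imp_le image_subset_iff)
  have c0: "inj_on c0 (topspace omega0)" "c0 ` topspace omega0 \<subseteq> {0..1}"
    using c1 by (auto simp: inj_on_def c0_def less_imp_le image_subset_iff)
  have disc: "discrete_topology (topspace omega1) = omega1"
      "discrete_topology (topspace omega0) = omega0"
    by (simp_all add: omega0_def omega1_def)
  show ?thesis
    unfolding V_space_def
  proof (rule realcompact_space_subtopology_compact)
    show "compact_space ?W" "Hausdorff_space ?W"
      by (simp_all add: compact_space_prod_topology Hausdorff_space_prod_topology
          compact_space_beta Hausdorff_space_beta)
    fix p
    let ?V = "topspace (beta omega1) \<times> topspace (beta omega0) - beta_remainder omega1 \<times> beta_remainder omega0"
    assume "p \<in> topspace ?W - ?V"
    then obtain u v where p: "p = (u, v)" and u: "u \<in> beta_remainder omega1" and v: "v \<in> beta_remainder omega0"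
      by auto
    obtain H where H: "continuous_map (beta omega1) euclideanreal H" "H u = 0"
        "\<And>s. s \<in> topspace omega1 \<Longrightarrow> H (beta_emb omega1 s) \<noteq> 0"
      using beta_remainder_vanishing_function[OF c1', of u] u unfolding disc by metis
    obtain G where G: "continuous_map (beta omega0) euclideanreal G" "G v = 0"
        "\<And>n. n \<in> topspace omega0 \<Longrightarrow> G (beta_emb omega0 n) \<noteq> 0"
      using beta_remainder_vanishing_function[OF c0, of v] v unfolding disc by metis
    let ?f = "\<lambda>q. \<bar>H (fst q)\<bar> + \<bar>G (snd q)\<bar>"
    have "continuous_map ?W euclideanreal ?f"
      using continuous_map_compose[OF continuous_map_fst H(1)]
        continuous_map_compose[OF continuous_map_snd G(1)]
      by (intro continuous_intros) (auto simp: o_def)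
    moreover have "?f p = 0"
      using p H G by simp
    moreover have "?f q \<noteq> 0" if "q \<in> ?V" for q
    proof -
      have "fst q \<in> beta_emb omega1 ` topspace omega1 \<or> snd q \<in> beta_emb omega0 ` topspace omega0"
        using that by (cases q) (auto simp: beta_remainder_def)
      then show ?thesis
        using H(3) G(3) by (auto simp: add_nonneg_eq_0_iff)
    qed
    ultimately show "\<exists>f. continuous_map ?W euclideanreal f \<and> f p = 0 \<and> (\<forall>x\<in>?V. f x \<noteq> 0)"
      by blast
  qed auto
qed


section \<open>Extension of bounded functions\<close>

lemma R_eq: "R_set = topspace V_space \<inter> (beta_remainder omega1 \<times> UNIV)"
  using beta_emb_in_topspace[of _ omega0]
  by (auto simp: R_set_def topspace_V beta_remainder_def)

lemma closedin_R: "closedin V_space R_set"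
proof -
  let ?W = "prod_topology (beta omega1) (beta omega0)"
  have "closedin ?W (beta_remainder omega1 \<times> topspace (beta omega0))"
    using closedin_beta_remainder[of "Field (cardSuc natLeq)"]
    by (simp add: closedin_prod_Times_iff omega1_def)
  moreover have "R_set = beta_remainder omega1 \<times> topspace (beta omega0) \<inter> topspace V_space"
    unfolding R_eq by (auto simp: topspace_V)
  ultimately show ?thesis
    unfolding V_space_def closedin_subtopology topspace_V[unfolded V_space_def] by blast
qed

lemma continuous_map_V_column:
  assumes "n \<in> topspace omega0"
  shows "continuous_map (beta omega1) V_space (\<lambda>x. (x, beta_emb omega0 n))"
  using beta_emb_in_topspace[OF assms] assms
  by (auto simp: V_space_def continuous_map_in_subtopology beta_remainder_def
      intro!: continuous_map_paired[THEN iffD2])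

lemma continuous_map_V_row:
  assumes "s \<in> topspace omega1"
  shows "continuous_map (beta omega0) V_space (\<lambda>y. (beta_emb omega1 s, y))"
  using beta_emb_in_topspace[OF assms] assms
  by (auto simp: V_space_def continuous_map_in_subtopology beta_remainder_def
      intro!: continuous_map_paired[THEN iffD2])

lemma C_star_embedded_R: "C_star_embedded V_space R_set"
  unfolding C_star_embedded_def
proof (intro conjI allI impI)
  show "R_set \<subseteq> topspace V_space"
    using closedin_R closedin_subset by blast
next
  let ?W = "prod_topology (beta omega1) (beta omega0)"
  let ?b1 = "beta_emb omega1" and ?b0 = "beta_emb omega0"
  fix f assume "continuous_map (subtopology V_space R_set) euclideanreal f \<and> bounded (f ` R_set)"
  then have f: "continuous_map (subtopology V_space R_set) euclideanreal f"
    and "bounded (f ` R_set)"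
    by auto
  then obtain B where B: "B > 0" "\<And>p. p \<in> R_set \<Longrightarrow> \<bar>f p\<bar> \<le> B"
    by (auto simp: bounded_pos)
  have normal: "normal_space (beta omega1)"
    using compact_Hausdorff_or_regular_imp_normal_space compact_space_beta Hausdorff_space_beta
    by blast
  have "\<exists>g. continuous_map (beta omega1) euclideanreal g \<and> g ` topspace (beta omega1) \<subseteq> {-B..B} \<and>
      (\<forall>x\<in>beta_remainder omega1. g x = f (x, ?b0 n))" for n
  proof -
    have "continuous_map (subtopology (beta omega1) (beta_remainder omega1))
        (subtopology V_space R_set) (\<lambda>x. (x, ?b0 n))"
      using continuous_map_V_column[of n]
      by (auto simp: continuous_map_in_subtopology continuous_map_from_subtopology R_set_def topspace_omega0)
    from continuous_map_compose[OF this f]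
    have "continuous_map (subtopology (beta omega1) (beta_remainder omega1)) euclideanreal
        (\<lambda>x. f (x, ?b0 n))"
      by (simp add: o_def)
    moreover
    have "f (x, ?b0 n) \<in> {-B..B}" if "x \<in> beta_remainder omega1" for x
      using B(2)[of "(x, ?b0 n)"] that by (auto simp: R_set_def topspace_omega0)
    then have "(\<lambda>x. f (x, ?b0 n)) ` beta_remainder omega1 \<subseteq> {-B..B}"
      by blast
    moreover have "closedin (beta omega1) (beta_remainder omega1)"
      using closedin_beta_remainder by (simp add: omega1_def)
    moreover have "is_interval {-B..B}" "{-B..B} \<noteq> {}"
      using B(1) by (auto simp: is_interval_cc)
    ultimately show ?thesis
      using Tietze_extension_realinterval[OF normal] by metis
  qed
  then obtain G where G: "\<And>n. continuous_map (beta omega1) euclideanreal (G n)"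
      "\<And>n x. x \<in> topspace (beta omega1) \<Longrightarrow> \<bar>G n x\<bar> \<le> B"
      "\<And>n x. x \<in> beta_remainder omega1 \<Longrightarrow> G n x = f (x, ?b0 n)"
    by (simp add: image_subset_iff abs_le_iff) (metis minus_le_iff)
  have "\<exists>h. continuous_map (beta omega0) euclideanreal h \<and> (\<forall>n. h (?b0 n) = G n (?b1 s)) \<and>
      (\<forall>y\<in>topspace (beta omega0). \<bar>h y\<bar> \<le> B)" if "s \<in> topspace omega1" for s
  proof -
    have "continuous_map omega0 euclideanreal (\<lambda>n. G n (?b1 s))"
      by (simp add: omega0_def)
    then show ?thesis
      using beta_extension[of omega0 "\<lambda>n. G n (?b1 s)" B] G(2) B(1) beta_emb_in_topspace[OF that]
      by (metis topspace_omega0 UNIV_I)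
  qed
  then obtain H where H: "\<And>s. s \<in> topspace omega1 \<Longrightarrow> continuous_map (beta omega0) euclideanreal (H s)"
      "\<And>s n. s \<in> topspace omega1 \<Longrightarrow> H s (?b0 n) = G n (?b1 s)"
      "\<And>s y. s \<in> topspace omega1 \<Longrightarrow> y \<in> topspace (beta omega0) \<Longrightarrow> \<bar>H s y\<bar> \<le> B"
    by metis
  \<comment> \<open>The open cover by columns (left summand) and rows (right summand), along which the functions
    \<open>G n\<close> and \<open>H s\<close> are glued.\<close>
  define T :: "nat + nat set \<Rightarrow> V_point set" where
    "T = case_sum (\<lambda>n. UNIV \<times> {?b0 n}) (\<lambda>s. {?b1 s} \<times> UNIV)"
  define \<Phi> where "\<Phi> = case_sum (\<lambda>n p. G n (fst p)) (\<lambda>s p. H s (snd p))"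
  define I :: "(nat + nat set) set" where "I = range Inl \<union> Inr ` topspace omega1"
  have inj1: "?b1 s = ?b1 t \<longleftrightarrow> s = t" if "s \<in> topspace omega1" "t \<in> topspace omega1" for s t
    using that inj_on_beta_emb[of "Field (cardSuc natLeq)"]
    by (auto simp: omega1_def inj_on_def)
  have inj0: "?b0 m = ?b0 n \<longleftrightarrow> m = n" for m n
    using inj_on_beta_emb[of "Field natLeq"] by (auto simp: omega0_def Field_natLeq inj_on_def)
  have cover: "\<exists>i\<in>I. p \<in> T i" if "p \<in> topspace V_space" for p
  proof -
    have "fst p \<in> ?b1 ` topspace omega1 \<or> snd p \<in> range ?b0"
      using that by (auto simp: topspace_V beta_remainder_def topspace_omega0)
    then show ?thesis
    proof
      assume "fst p \<in> ?b1 ` topspace omega1"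
      then obtain s where "s \<in> topspace omega1" "fst p = ?b1 s" by blast
      then show ?thesis
        by (intro bexI[of _ "Inr s"]) (auto simp: I_def T_def mem_Times_iff)
    next
      assume "snd p \<in> range ?b0"
      then obtain n where "snd p = ?b0 n" by blast
      then show ?thesis
        by (intro bexI[of _ "Inl n"]) (auto simp: I_def T_def mem_Times_iff)
    qed
  qed
  have agree: "\<Phi> i p = \<Phi> j p" if "i \<in> I" "j \<in> I" "p \<in> topspace V_space \<inter> T i \<inter> T j" for i j p
    using that inj1 inj0 H(2) by (auto simp: I_def T_def \<Phi>_def)
  define g where "g p = \<Phi> (SOME i. i \<in> I \<and> p \<in> T i) p" for p
  have some: "(SOME i. i \<in> I \<and> p \<in> T i) \<in> I \<and> p \<in> T (SOME i. i \<in> I \<and> p \<in> T i)"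
    if "p \<in> topspace V_space" for p
    using someI_ex[of "\<lambda>i. i \<in> I \<and> p \<in> T i"] cover[OF that] by blast
  have g: "g p = \<Phi> i p" if "i \<in> I" "p \<in> topspace V_space" "p \<in> T i" for i p
    unfolding g_def using some[of p] that agree by blast
  have cont: "continuous_map V_space euclideanreal g"
  proof (rule pasting_lemma)
    fix i assume i: "i \<in> I"
    have "openin ?W (topspace ?W \<inter> T i)"
    proof (cases i)
      case (Inl n)
      have "openin (beta omega0) {?b0 n}"
        using openin_beta_singleton[of n "Field natLeq"] by (simp add: omega0_def Field_natLeq)
      moreover have "topspace ?W \<inter> T i = topspace (beta omega1) \<times> {?b0 n}"
        using Inl beta_emb_in_topspace[of n omega0] by (auto simp: T_def topspace_omega0)
      ultimately show ?thesis
        by (simp add: openin_prod_Times_iff)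
    next
      case (Inr s)
      then have s: "s \<in> topspace omega1"
        using i by (auto simp: I_def)
      then have "openin (beta omega1) {?b1 s}"
        using openin_beta_singleton by (simp add: omega1_def)
      moreover have "topspace ?W \<inter> T i = {?b1 s} \<times> topspace (beta omega0)"
        using Inr beta_emb_in_topspace[OF s] by (auto simp: T_def)
      ultimately show ?thesis
        by (simp add: openin_prod_Times_iff)
    qed
    moreover have "topspace V_space \<inter> T i = topspace ?W \<inter> T i \<inter> topspace V_space"
      by (auto simp: topspace_V)
    ultimately show "openin V_space (topspace V_space \<inter> T i)"
      unfolding V_space_def openin_subtopology by (metis topspace_V V_space_def)
    have "continuous_map ?W euclideanreal (\<Phi> i)"
      using i continuous_map_compose[OF continuous_map_fst G(1)]
        continuous_map_compose[OF continuous_map_snd H(1)]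
      by (auto simp: I_def \<Phi>_def o_def)
    then show "continuous_map (subtopology V_space (topspace V_space \<inter> T i)) euclideanreal (\<Phi> i)"
      by (simp add: V_space_def continuous_map_from_subtopology)
  qed (use agree g cover in blast)+
  have bnd: "\<bar>g p\<bar> \<le> B" if p: "p \<in> topspace V_space" for p
  proof -
    obtain i where i: "i \<in> I" "p \<in> T i"
      using cover p by blast
    then have "\<bar>\<Phi> i p\<bar> \<le> B"
      using p G(2) H(3) by (auto simp: I_def T_def \<Phi>_def topspace_V)
    then show ?thesis
      using g i p by simp
  qed
  have "g p = f p" if p: "p \<in> R_set" for p
  proof -
    obtain x n where xn: "p = (x, ?b0 n)" "x \<in> beta_remainder omega1"
      using p by (auto simp: R_set_def)
    then have "g p = \<Phi> (Inl n) p"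
      using p by (intro g) (auto simp: I_def T_def R_eq)
    then show ?thesis
      using xn G(3) by (simp add: \<Phi>_def)
  qed
  moreover have "bounded (g ` topspace V_space)"
    unfolding bounded_iff using bnd by (metis (no_types, lifting) imageE real_norm_def)
  ultimately show "\<exists>g. continuous_map V_space euclideanreal g \<and> bounded (g ` topspace V_space) \<and>
      (\<forall>x\<in>R_set. g x = f x)"
    using cont by blast
qed


section \<open>An unbounded function without extension\<close>

lemma not_C_embedded_R: "\<not> C_embedded V_space R_set"
proof
  assume C: "C_embedded V_space R_set"
  let ?b1 = "beta_emb omega1" and ?b0 = "beta_emb omega0"
  have "continuous_map omega0 euclideanreal (\<lambda>n. 1 / (real n + 1))"
    by (simp add: omega0_def)
  moreover have "\<And>n. \<bar>1 / (real n + 1)\<bar> \<le> 1"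
    by simp
  ultimately obtain N where N: "continuous_map (beta omega0) euclideanreal N"
      "\<And>n. N (?b0 n) = 1 / (real n + 1)"
    using beta_extension[of omega0 "\<lambda>n. 1 / (real n + 1)" 1] by (metis UNIV_I topspace_omega0 zero_less_one)
  \<comment> \<open>On \<open>R\<close> this is the index of the column; the detour over the extension of \<open>1 / (n + 1)\<close> gives its
    continuity for free.\<close>
  let ?f = "\<lambda>p::V_point. inverse (N (snd p)) - 1"
  have "continuous_map V_space euclideanreal (\<lambda>p. N (snd p))"
    using continuous_map_compose[OF continuous_map_snd N(1)]
    unfolding V_space_def by (auto simp: o_def intro!: continuous_map_from_subtopology)
  moreover have "N (snd p) \<noteq> 0" if "p \<in> R_set" for p
    using that N(2) by (auto simp: R_set_def add_nonneg_eq_0_iff)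
  ultimately have "continuous_map (subtopology V_space R_set) euclideanreal ?f"
    by (intro continuous_intros) (auto intro: continuous_map_from_subtopology)
  then obtain g where g: "continuous_map V_space euclideanreal g" "\<And>p. p \<in> R_set \<Longrightarrow> g p = ?f p"
    using C unfolding C_embedded_def by blast
  have gR: "g (x, ?b0 n) = n" if "x \<in> beta_remainder omega1" for x n
    using that g(2)[of "(x, ?b0 n)"] N(2) by (simp add: R_set_def topspace_omega0)
  define E where "E n = {x \<in> topspace (beta omega1). \<bar>g (x, ?b0 n) - n\<bar> \<ge> 1}" for n
  have "finite (E n)" for n
  proof -
    have "continuous_map (beta omega1) euclideanreal (\<lambda>x. g (x, ?b0 n))"
      using continuous_map_compose[OF continuous_map_V_column g(1)]
      by (simp add: o_def topspace_omega0)
    then have "continuous_map (beta omega1) euclideanreal (\<lambda>x. \<bar>g (x, ?b0 n) - n\<bar>)"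
      by (intro continuous_intros) auto
    from closedin_continuous_map_preimage[OF this, of "{1..}"]
    have "closedin (beta omega1) (E n)"
      by (simp add: E_def)
    moreover have "E n \<inter> beta_remainder omega1 = {}"
      using gR by (auto simp: E_def)
    ultimately show ?thesis
      using finite_closedin_beta unfolding omega1_def by blast
  qed
  then have "countable (\<Union>n. E n)"
    by (simp add: uncountable_infinite countable_finite)
  moreover have "uncountable (?b1 ` topspace omega1)"
    using uncountable_topspace_omega1 inj_on_beta_emb[of "Field (cardSuc natLeq)"]
    by (auto simp: omega1_def countable_image_inj_eq)
  ultimately have "\<not> ?b1 ` topspace omega1 \<subseteq> (\<Union>n. E n)"
    using countable_subset by blast
  then obtain s where s: "s \<in> topspace omega1" "\<And>n. ?b1 s \<notin> E n"
    by blast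
  have "continuous_map (beta omega0) euclideanreal (\<lambda>y. g (?b1 s, y))"
    using continuous_map_compose[OF continuous_map_V_row[OF s(1)] g(1)] by (simp add: o_def)
  then have "compact ((\<lambda>y. g (?b1 s, y)) ` topspace (beta omega0))"
    using image_compactin compact_space_beta unfolding compact_space_def by fastforce
  from compact_imp_bounded[OF this]
  obtain M where M: "\<forall>y\<in>topspace (beta omega0). \<bar>g (?b1 s, y)\<bar> \<le> M"
    by (auto simp: bounded_iff)
  obtain n where n: "real n > M + 1"
    using reals_Archimedean2 by blast
  have "\<bar>g (?b1 s, ?b0 n)\<bar> \<le> M"
    using M beta_emb_in_topspace[of n omega0] by (simp add: topspace_omega0)
  moreover have "\<bar>g (?b1 s, ?b0 n) - n\<bar> < 1"
    using s beta_emb_in_topspace[OF s(1)] by (auto simp: E_def not_le)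
  ultimately show False
    using n by linarith
qed

theorem mainTheorem1:
  shows "realcompact_space V_space \<and>
         closedin V_space R_set \<and>
         C_star_embedded V_space R_set \<and>
         \<not> C_embedded V_space R_set"
  using realcompact_V closedin_R C_star_embedded_R not_C_embedded_R by blast

end
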